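(* Let $\kappa_1,\kappa_2>0$ and $u_0>0$. For $i=1,2$ let $u_i=u_i(\cdot;u_0,\kappa_i):\mathbb{R}\to\mathbb{R}$ be the solution of $$\frac{u_i''(r)}{(1-u_i'(r)^2)^{3/2}}=\kappa_i\,u_i(r),\qquad u_i(0)=u_0,\quad u_i'(0)=0,\quad |u_i'|<1,$$ with the same initial condition $u_0$. If $\kappa_1<\kappa_2$, then $u_1(r)<u_2(r)$ for every $r\neq 0$ and $u_1'(r)<u_2'(r)$ for every $r>0$.
   Context: Each initial value problem has a unique solution, whose maximal interval of definition is $\mathbb{R}$. *)

theory Defs
  imports "HOL-Analysis.Analysis"
begin

text \<open>A classical solution on the whole real line of the initial value problem with parameter
  \<open>\<kappa>\<close> and initial height \<open>u0\<close>. The two differentiability clauses are needed because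
  \<^const>\<open>deriv\<close> is total and carries no information where the derivative does not exist;
  continuity of the second derivative then follows from the equation. The base of
  \<open>powr\<close> is positive since \<open>\<bar>u'\<bar> < 1\<close>.\<close>

definition ivp_solution :: "real \<Rightarrow> real \<Rightarrow> (real \<Rightarrow> real) \<Rightarrow> bool" where
  "ivp_solution \<kappa> u0 u \<longleftrightarrow>
     (\<forall>r. u differentiable at r) \<and>
     (\<forall>r. deriv u differentiable at r) \<and>
     (\<forall>r. \<bar>deriv u r\<bar> < 1) \<and>
     (\<forall>r. deriv (deriv u) r / (1 - (deriv u r)\<^sup>2) powr (3/2) = \<kappa> * u r) \<and>
     u 0 = u0 \<and> deriv u 0 = 0"

end

theory Submission imports Defs begin

text \<open>The left-hand side of the equation is the derivative of
  \<open>u' / sqrt (1 - u'\<^sup>2)\<close>, the relativistic momentum of a particle of velocity \<open>u'\<close>. The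
  equation therefore says that the momentum \<open>w\<close> of a solution satisfies \<open>w' = \<kappa> u\<close>, and since
  momentum is a strictly increasing function of velocity, momenta and velocities are ordered alike.

  The comparison is a first-crossing argument for \<open>g = \<kappa>2 u2 - \<kappa>1 u1\<close>, the derivative of
  the difference of the momenta. Initially \<open>g = (\<kappa>2 - \<kappa>1) u0 > 0\<close>. As long as \<open>g > 0\<close>, the
  difference of the momenta grows from \<open>0\<close>, so \<open>u2' > u1'\<close> and hence \<open>u2 > u1\<close>. At a first
  zero of \<open>g\<close> this would give \<open>\<kappa>2 u2 > \<kappa>2 u1 > \<kappa>1 u1\<close>, which is absurd (\<open>momentum_rate_less\<close>).
  So \<open>g\<close> never vanishes on the half-line, and the same reasoning yields both inequalities there.
  Negative arguments are reached by reflection.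

  The step \<open>\<kappa>2 u1 > \<kappa>1 u1\<close> needs \<open>u1 > 0\<close>. That comes from conservation of energy: a solution
  satisfies \<open>1 / sqrt (1 - u'\<^sup>2) = 1 + \<kappa> (u\<^sup>2 - u0\<^sup>2) / 2\<close>, whose left side is at least
  \<open>1\<close>, so \<open>u\<^sup>2 \<ge> u0\<^sup>2\<close> and \<open>u\<close> cannot change sign (\<open>ivp_solution_pos\<close>).\<close>

definition momentum :: "real \<Rightarrow> real" where
  "momentum v = v * (1 - v\<^sup>2) powr (-1/2)"

lemma one_minus_square_pos:
  fixes v :: real
  assumes "\<bar>v\<bar> < 1"
  shows "0 < 1 - v\<^sup>2"
  using assms by (simp add: abs_square_less_1)

lemma momentum_deriv:
  assumes "\<bar>v\<bar> < 1"
  shows "(momentum has_real_derivative (1 - v\<^sup>2) powr (-3/2)) (at v)"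
proof -
  let ?b = "1 - v\<^sup>2"
  have pos: "0 < ?b"
    using assms by (rule one_minus_square_pos)
  have "?b powr (-1/2) = ?b * ?b powr (-3/2)"
    using powr_mult_base[of ?b "-3/2"] pos by simp
  then have eq: "?b powr (-1/2) + v\<^sup>2 * ?b powr (-3/2) = ?b powr (-3/2)"
    by (simp add: algebra_simps)
  show ?thesis
    unfolding momentum_def[abs_def]
    using pos eq
    by (auto intro!: derivative_eq_intros simp: power2_eq_square algebra_simps)
qed

lemma momentum_less_imp_less:
  assumes "\<bar>a\<bar> < 1" "\<bar>b\<bar> < 1" "momentum a < momentum b"
  shows "a < b"
proof (rule ccontr)
  assume "\<not> a < b"
  then have "b < a"
    using assms(3) by (cases "a = b") auto
  have "momentum b < momentum a"
  proof (rule DERIV_pos_imp_increasing[OF \<open>b < a\<close>])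
    fix x assume "b \<le> x" "x \<le> a"
    then have "\<bar>x\<bar> < 1"
      using assms(1,2) by linarith
    then show "\<exists>y. (momentum has_real_derivative y) (at x) \<and> 0 < y"
      using momentum_deriv one_minus_square_pos by fastforce
  qed
  then show False
    using assms(3) by simp
qed

context
  fixes \<kappa> u0 :: real and u :: "real \<Rightarrow> real"
  assumes sol: "ivp_solution \<kappa> u0 u"
begin

lemma ivp_solution_initial: "u 0 = u0" "deriv u 0 = 0"
  using sol by (auto simp: ivp_solution_def)

lemma ivp_solution_slope: "\<bar>deriv u r\<bar> < 1"
  using sol by (auto simp: ivp_solution_def)

lemma ivp_solution_deriv: "(u has_real_derivative deriv u r) (at r)"
  using sol by (auto simp: ivp_solution_def DERIV_deriv_iff_real_differentiable)

lemma ivp_solution_deriv2: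
  "(deriv u has_real_derivative \<kappa> * u r * (1 - (deriv u r)\<^sup>2) powr (3/2)) (at r)"
proof -
  have "(1 - (deriv u r)\<^sup>2) powr (3/2) \<noteq> 0"
    using one_minus_square_pos[OF ivp_solution_slope[of r]] by simp
  moreover have "deriv (deriv u) r / (1 - (deriv u r)\<^sup>2) powr (3/2) = \<kappa> * u r"
    using sol by (simp add: ivp_solution_def)
  ultimately have "deriv (deriv u) r = \<kappa> * u r * (1 - (deriv u r)\<^sup>2) powr (3/2)"
    by (rule iffD1[OF nonzero_divide_eq_eq])
  moreover have "(deriv u has_real_derivative deriv (deriv u) r) (at r)"
    using sol by (auto simp: ivp_solution_def DERIV_deriv_iff_real_differentiable)
  ultimately show ?thesis
    by simp
qed

lemma ivp_solution_momentum_deriv: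
  "((\<lambda>r. momentum (deriv u r)) has_real_derivative \<kappa> * u r) (at r)"
proof -
  let ?b = "1 - (deriv u r)\<^sup>2"
  have "0 < ?b"
    by (intro one_minus_square_pos ivp_solution_slope)
  then have "?b powr (-3/2) * ?b powr (3/2) = 1"
    by (simp flip: powr_add)
  then have "?b powr (-3/2) * (\<kappa> * u r * ?b powr (3/2)) = \<kappa> * u r"
    by algebra
  then show ?thesis
    using DERIV_chain2[OF momentum_deriv[OF ivp_solution_slope] ivp_solution_deriv2, of r]
    by (simp only:)
qed

text \<open>Conservation of energy: \<open>(1 - u'\<^sup>2) powr (-1/2)\<close> is the kinetic energy (with rest energy
  \<open>1\<close>) and \<open>- \<kappa> u\<^sup>2 / 2\<close> is the potential of the force \<open>\<kappa> u\<close>.\<close>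

lemma ivp_solution_energy:
  "(1 - (deriv u r)\<^sup>2) powr (-1/2) = 1 + \<kappa> / 2 * ((u r)\<^sup>2 - u0\<^sup>2)"
proof -
  let ?E = "\<lambda>r. (1 - (deriv u r)\<^sup>2) powr (-1/2) - \<kappa> / 2 * (u r)\<^sup>2"
  have "(?E has_real_derivative 0) (at x)" for x
  proof -
    let ?b = "1 - (deriv u x)\<^sup>2"
    have pos: "0 < ?b"
      by (intro one_minus_square_pos ivp_solution_slope)
    have cancel: "?b powr (-3/2) * ?b powr (3/2) = 1"
      using pos by (simp flip: powr_add)
    have "(?E has_real_derivative
        (deriv u x * (?b powr (-3/2) * ?b powr (3/2)) * (\<kappa> * u x) - \<kappa> * u x * deriv u x)) (at x)"
      using pos
      by (auto intro!: derivative_eq_intros ivp_solution_deriv ivp_solution_deriv2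
               simp: algebra_simps)
    then show ?thesis
      unfolding cancel by (simp add: algebra_simps)
  qed
  then have "?E r = ?E 0"
    by (intro DERIV_isconst_all) auto
  then show ?thesis
    by (simp add: ivp_solution_initial algebra_simps)
qed

text \<open>The kinetic energy never falls below the rest energy, so \<open>\<bar>u\<bar>\<close> never falls below its initial
  value, and a continuous function bounded away from zero keeps its sign.\<close>

lemma ivp_solution_pos:
  assumes "0 < \<kappa>" "0 < u0"
  shows "0 < u r"
proof (rule ccontr)
  assume "\<not> 0 < u r"
  moreover have "continuous_on UNIV u"
    using ivp_solution_deriv DERIV_isCont continuous_at_imp_continuous_on by blast
  ultimately obtain z where "u z = 0"
    using assms(2) ivp_solution_initial(1)
      connected_ivt_hyperplane[of "range u" "u r" u0 1 0]
      connected_continuous_image[of UNIV u]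
    by (force simp: connected_UNIV)
  then have E: "(1 - (deriv u z)\<^sup>2) powr (-1/2) = 1 - \<kappa> / 2 * u0\<^sup>2"
    using ivp_solution_energy[of z] by simp
  let ?b = "1 - (deriv u z)\<^sup>2"
  have "0 < ?b" "?b \<le> 1"
    using one_minus_square_pos[OF ivp_solution_slope[of z]] by auto
  then have "1 \<le> ?b powr (-1/2)"
    using powr_mono2'[of "-1/2" ?b 1] by simp
  then have "\<kappa> / 2 * u0\<^sup>2 \<le> 0"
    using E by simp
  moreover have "0 < \<kappa> / 2 * u0\<^sup>2"
    using assms by simp
  ultimately show False
    by simp
qed

lemma ivp_solution_reflect: "ivp_solution \<kappa> u0 (\<lambda>r. u (- r))"
proof -
  have d1: "((\<lambda>r. u (- r)) has_real_derivative - deriv u (- r)) (at r)" for r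
    using DERIV_chain2[OF ivp_solution_deriv DERIV_minus[OF DERIV_ident], of r] by simp
  then have v: "deriv (\<lambda>r. u (- r)) = (\<lambda>r. - deriv u (- r))"
    using DERIV_imp_deriv by blast
  have d2: "((\<lambda>r. - deriv u (- r)) has_real_derivative deriv (deriv u) (- r)) (at r)" for r
  proof -
    have "(deriv u has_real_derivative deriv (deriv u) (- r)) (at (- r))"
      using ivp_solution_deriv2 DERIV_imp_deriv by metis
    then have "((\<lambda>r. deriv u (- r)) has_real_derivative deriv (deriv u) (- r) * (-1)) (at r)"
      by (rule DERIV_chain2) (auto intro!: derivative_eq_intros)
    from DERIV_minus[OF this] show ?thesis
      by simp
  qed
  then have a: "deriv (\<lambda>r. - deriv u (- r)) = (\<lambda>r. deriv (deriv u) (- r))"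
    using DERIV_imp_deriv by blast
  show ?thesis
    unfolding ivp_solution_def v a
    using sol d1 d2
    by (auto simp: ivp_solution_def real_differentiable_def)
qed

end

context
  fixes \<kappa>1 \<kappa>2 u0 :: real and u1 u2 :: "real \<Rightarrow> real"
  assumes sol1: "ivp_solution \<kappa>1 u0 u1" and sol2: "ivp_solution \<kappa>2 u0 u2"
begin

lemma slope_less_if_momentum_rate_less:
  assumes "0 < r" and rate: "\<And>x. \<lbrakk>0 \<le> x; x < r\<rbrakk> \<Longrightarrow> \<kappa>1 * u1 x < \<kappa>2 * u2 x"
  shows "deriv u1 r < deriv u2 r"
proof -
  let ?w = "\<lambda>x. momentum (deriv u2 x) - momentum (deriv u1 x)"
  have d: "(?w has_real_derivative \<kappa>2 * u2 x - \<kappa>1 * u1 x) (at x)" for x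
    by (intro DERIV_diff ivp_solution_momentum_deriv[OF sol1] ivp_solution_momentum_deriv[OF sol2])
  have "?w 0 < ?w r"
  proof (rule DERIV_pos_imp_increasing_open[OF \<open>0 < r\<close>])
    fix x assume "0 < x" "x < r"
    then show "\<exists>y. (?w has_real_derivative y) (at x) \<and> 0 < y"
      using d rate by (intro exI[of _ "\<kappa>2 * u2 x - \<kappa>1 * u1 x"]) auto
  next
    show "continuous_on {0..r} ?w"
      using d DERIV_isCont continuous_at_imp_continuous_on by blast
  qed
  then have "momentum (deriv u1 r) < momentum (deriv u2 r)"
    by (simp add: ivp_solution_initial(2)[OF sol1] ivp_solution_initial(2)[OF sol2])
  then show ?thesis
    using momentum_less_imp_less ivp_solution_slope[OF sol1] ivp_solution_slope[OF sol2] by blast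
qed

lemma less_if_momentum_rate_less:
  assumes "0 < r" and rate: "\<And>x. \<lbrakk>0 \<le> x; x < r\<rbrakk> \<Longrightarrow> \<kappa>1 * u1 x < \<kappa>2 * u2 x"
  shows "u1 r < u2 r"
proof -
  let ?d = "\<lambda>x. u2 x - u1 x"
  have d: "(?d has_real_derivative deriv u2 x - deriv u1 x) (at x)" for x
    by (intro DERIV_diff ivp_solution_deriv[OF sol1] ivp_solution_deriv[OF sol2])
  have "?d 0 < ?d r"
  proof (rule DERIV_pos_imp_increasing_open[OF \<open>0 < r\<close>])
    fix x assume x: "0 < x" "x < r"
    then have "deriv u1 x < deriv u2 x"
      by (intro slope_less_if_momentum_rate_less rate) auto
    then show "\<exists>y. (?d has_real_derivative y) (at x) \<and> 0 < y"
      using d by (intro exI[of _ "deriv u2 x - deriv u1 x"]) auto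
  next
    show "continuous_on {0..r} ?d"
      using d DERIV_isCont continuous_at_imp_continuous_on by blast
  qed
  then show ?thesis
    by (simp add: ivp_solution_initial(1)[OF sol1] ivp_solution_initial(1)[OF sol2])
qed

text \<open>The first-crossing argument. The two preceding lemmas assume the inequality of the rates only
  strictly before \<open>r\<close>, so they apply at the first point where it fails.\<close>

lemma momentum_rate_less:
  assumes "0 < \<kappa>1" "\<kappa>1 < \<kappa>2" "0 < u0" "0 \<le> r"
  shows "\<kappa>1 * u1 r < \<kappa>2 * u2 r"
proof (rule ccontr)
  let ?g = "\<lambda>x. \<kappa>2 * u2 x - \<kappa>1 * u1 x"
  let ?S = "{x \<in> {0..r}. ?g x \<le> 0}"
  assume "\<not> ?thesis"
  then have "?S \<noteq> {}"
    using assms(4) by force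
  moreover have "compact ?S"
  proof -
    have "continuous_on UNIV u1" "continuous_on UNIV u2"
      using ivp_solution_deriv[OF sol1] ivp_solution_deriv[OF sol2]
        DERIV_isCont continuous_at_imp_continuous_on by blast+
    then have "closed {x. ?g x \<le> 0}"
      by (intro closed_Collect_le continuous_intros) auto
    then have "compact ({0..r} \<inter> {x. ?g x \<le> 0})"
      by (intro compact_Int_closed) auto
    then show ?thesis
      by (simp add: Int_def)
  qed
  ultimately obtain s where "s \<in> ?S" and first: "\<And>x. x \<in> ?S \<Longrightarrow> s \<le> x"
    using compact_attains_inf[of ?S] by blast
  then have s: "0 \<le> s" "s \<le> r" "\<kappa>2 * u2 s \<le> \<kappa>1 * u1 s"
    by auto
  have "\<kappa>1 * u0 < \<kappa>2 * u0"
    using assms by simp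
  then have "s \<noteq> 0"
    using s(3) ivp_solution_initial(1)[OF sol1] ivp_solution_initial(1)[OF sol2] by auto
  have "\<kappa>1 * u1 x < \<kappa>2 * u2 x" if "0 \<le> x" "x < s" for x
    using first[of x] that s(2) by (force simp: not_le)
  then have "u1 s < u2 s"
    using s(1) \<open>s \<noteq> 0\<close> by (intro less_if_momentum_rate_less) auto
  moreover have "0 < u1 s"
    using ivp_solution_pos[OF sol1] assms by blast
  ultimately have "\<kappa>1 * u1 s < \<kappa>2 * u2 s"
    using assms by (intro mult_strict_mono) auto
  then show False
    using s(3) by simp
qed

end

theorem theorem4p4:
  fixes \<kappa>1 \<kappa>2 u0 :: real and u1 u2 :: "real \<Rightarrow> real"
  assumes "\<kappa>1 > 0" and "\<kappa>2 > 0" and "u0 > 0"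
    and "ivp_solution \<kappa>1 u0 u1"
    and "ivp_solution \<kappa>2 u0 u2"
    and "\<kappa>1 < \<kappa>2"
  shows "(\<forall>r. r \<noteq> 0 \<longrightarrow> u1 r < u2 r) \<and> (\<forall>r>0. deriv u1 r < deriv u2 r)"
proof -
  have right: "v1 r < v2 r" if "ivp_solution \<kappa>1 u0 v1" "ivp_solution \<kappa>2 u0 v2" "0 < r" for v1 v2 r
    by (rule less_if_momentum_rate_less[OF that])
      (use momentum_rate_less[OF that(1,2)] assms in blast)
  have "u1 r < u2 r" if "r < 0" for r
    using right[OF ivp_solution_reflect ivp_solution_reflect, OF assms(4,5), of "- r"] that by simp
  moreover have "deriv u1 r < deriv u2 r" if "0 < r" for r
    by (rule slope_less_if_momentum_rate_less[OF assms(4,5) that])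
      (use momentum_rate_less[OF assms(4,5)] assms in blast)
  ultimately show ?thesis
    using right[OF assms(4,5)] by (metis linorder_neqE_linordered_idom)
qed

end
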